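(* Let $\lambda,\mu\in\mathbb{C}^*$ and $\alpha,\beta\in\mathbb{C}$. Then $\Omega_{\mathcal{R}}(\lambda,\alpha)\cong\Omega_{\mathcal{R}}(\mu,\beta)$ as $\mathcal{R}$-modules if and only if $\lambda=\mu$ and $\alpha=\beta$.
   Context: All spaces are over $\mathbb{C}$; $\mathbb{C}^*$ is the set of nonzero complex numbers. The Ramond algebra $\mathcal{R}$ is the Lie superalgebra whose even part has basis $\{L_n\mid n\in\mathbb{Z}\}$ and whose odd part has basis $\{G_r\mid r\in\mathbb{Z}\}$, with brackets $[L_m,L_n]=(m-n)L_{m+n}$, $[L_m,G_r]=(\frac m2-r)G_{m+r}$, $[G_r,G_s]=2L_{r+s}$. A module over a Lie superalgebra $A$ always means a supermodule $M=M_{\bar 0}\oplus M_{\bar 1}$ with $A_{\bar i}\cdot M_{\bar j}\subseteq M_{\bar i+\bar j}$; $\cong$ denotes (parity-preserving) isomorphism of supermodules. For $\lambda\in\mathbb{C}^*$, $\alpha\in\mathbb{C}$, $\Omega_{\mathcal{R}}(\lambda,\alpha)$ is the $\mathcal{R}$-module with underlying space $\mathbb{C}[x^2]\oplus x\mathbb{C}[x^2]$ (part $\bar 0$ is $\mathbb{C}[x^2]$, part $\bar 1$ is $x\mathbb{C}[x^2]$) and action, for $m\in\mathbb{Z}$ and $f(x^2)\in\mathbb{C}[x^2]$: $L_mf(x^2)=\lambda^m(x^2+m\alpha)f(x^2+m)$, $L_m\,xf(x^2)=\lambda^mx(x^2+m\alpha+\frac m2)f(x^2+m)$, $G_mf(x^2)=\lambda^mxf(x^2+m)$,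 $G_m\,xf(x^2)=\lambda^m(x^2+2m\alpha)f(x^2+m)$. *)

theory Defs
  imports
    Complex_Main
    "HOL-Library.Z2"
    "HOL-Library.Poly_Mapping"
    "HOL-Computational_Algebra.Polynomial"
begin

section \<open>Lie superalgebras and their supermodules over the complex numbers\<close>

text \<open>
  The \<open>\<int>/2\<close>-grading is indexed by the two-element field \<^typ>\<open>bit\<close>, so that sums of parities are
  taken modulo 2. The carrier of a structure is the whole underlying type.
\<close>

record 'v superspace =
  smul :: "complex \<Rightarrow> 'v \<Rightarrow> 'v"
  part :: "bit \<Rightarrow> 'v set"

record 'a superalgebra = "'a superspace" +
  bracket :: "'a \<Rightarrow> 'a \<Rightarrow> 'a"

record ('a, 'm) supermodule = "'m superspace" +
  action :: "'a \<Rightarrow> 'm \<Rightarrow> 'm"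

definition parity_sign :: "bit \<Rightarrow> bit \<Rightarrow> complex" where
  "parity_sign i j = (if i = 1 \<and> j = 1 then -1 else 1)"

locale super_vector_space = vector_space "smul V"
  for V :: "('v::ab_group_add, 'x) superspace_scheme" +
  assumes subspace_part: "subspace (part V i)"
    and part_Int: "part V 0 \<inter> part V 1 = {0}"
    and part_sum: "\<exists>a\<in>part V 0. \<exists>b\<in>part V 1. v = a + b"

locale lie_superalgebra = super_vector_space A
  for A :: "('a::ab_group_add, 'x) superalgebra_scheme" +
  assumes bracket_linear_right: "Vector_Spaces.linear (smul A) (smul A) (\<lambda>b. bracket A a b)"
    and bracket_linear_left: "Vector_Spaces.linear (smul A) (smul A) (\<lambda>a. bracket A a b)"
    and bracket_part: "\<lbrakk>a \<in> part A i; b \<in> part A j\<rbrakk> \<Longrightarrow> bracket A a b \<in> part A (i + j)"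
    and super_skew: "\<lbrakk>a \<in> part A i; b \<in> part A j\<rbrakk> \<Longrightarrow>
      bracket A a b = smul A (- parity_sign i j) (bracket A b a)"
    and super_jacobi: "\<lbrakk>a \<in> part A i; b \<in> part A j; c \<in> part A k\<rbrakk> \<Longrightarrow>
      bracket A a (bracket A b c) =
        bracket A (bracket A a b) c + smul A (parity_sign i j) (bracket A b (bracket A a c))"

locale lie_supermodule = lie_superalgebra A + M: super_vector_space M
  for A :: "('a::ab_group_add, 'x) superalgebra_scheme"
    and M :: "('a, 'm::ab_group_add, 'y) supermodule_scheme" +
  assumes action_linear_right: "Vector_Spaces.linear (smul M) (smul M) (\<lambda>v. action M a v)"
    and action_linear_left: "Vector_Spaces.linear (smul A) (smul M) (\<lambda>a. action M a v)"
    and action_part: "\<lbrakk>a \<in> part A i; v \<in> part M j\<rbrakk> \<Longrightarrow> action M a v \<in> part M (i + j)"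
    and action_bracket: "\<lbrakk>a \<in> part A i; b \<in> part A j\<rbrakk> \<Longrightarrow>
      action M (bracket A a b) v =
        action M a (action M b v) - smul M (parity_sign i j) (action M b (action M a v))"

locale supermodule_isomorphism =
  source: lie_supermodule A M + target: lie_supermodule A N
  for A :: "('a::ab_group_add, 'x) superalgebra_scheme"
    and M :: "('a, 'm::ab_group_add, 'y) supermodule_scheme"
    and N :: "('a, 'n::ab_group_add, 'z) supermodule_scheme" +
  fixes \<phi> :: "'m \<Rightarrow> 'n"
  assumes iso_linear: "Vector_Spaces.linear (smul M) (smul N) \<phi>"
    and iso_bij: "bij \<phi>"
    and iso_part: "v \<in> part M i \<Longrightarrow> \<phi> v \<in> part N i"
    and iso_action: "\<phi> (action M a v) = action N a (\<phi> v)"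

definition isomorphic_supermodules ::
  "('a::ab_group_add, 'x) superalgebra_scheme \<Rightarrow> ('a, 'm::ab_group_add, 'y) supermodule_scheme
    \<Rightarrow> ('a, 'n::ab_group_add, 'z) supermodule_scheme \<Rightarrow> bool" where
  "isomorphic_supermodules A M N \<longleftrightarrow> (\<exists>\<phi>. supermodule_isomorphism A M N \<phi>)"


section \<open>Linear extension from a basis\<close>

definition pm_scale :: "complex \<Rightarrow> ('b \<Rightarrow>\<^sub>0 complex) \<Rightarrow> ('b \<Rightarrow>\<^sub>0 complex)" where
  "pm_scale c u = Poly_Mapping.map (\<lambda>z. c * z) u"

definition linear_extension ::
  "(complex \<Rightarrow> 'v \<Rightarrow> 'v) \<Rightarrow> ('b \<Rightarrow> 'v) \<Rightarrow> ('b \<Rightarrow>\<^sub>0 complex) \<Rightarrow> 'v::ab_group_add" where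
  "linear_extension s f u = (\<Sum>b\<in>Poly_Mapping.keys u. s (Poly_Mapping.lookup u b) (f b))"


section \<open>The Ramond algebra\<close>

datatype ramond_basis = L int | G int

type_synonym ramond = "ramond_basis \<Rightarrow>\<^sub>0 complex"

fun basis_parity :: "ramond_basis \<Rightarrow> bit" where
  "basis_parity (L m) = 0"
| "basis_parity (G r) = 1"

text \<open>The third equation is \<open>[G\<^sub>r, L\<^sub>m] = - [L\<^sub>m, G\<^sub>r]\<close>, forced by super skew-symmetry.\<close>

fun basis_bracket :: "ramond_basis \<Rightarrow> ramond_basis \<Rightarrow> ramond" where
  "basis_bracket (L m) (L n) = Poly_Mapping.single (L (m + n)) (of_int m - of_int n)"
| "basis_bracket (L m) (G r) = Poly_Mapping.single (G (m + r)) (of_int m / 2 - of_int r)"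
| "basis_bracket (G r) (L m) = Poly_Mapping.single (G (m + r)) (- (of_int m / 2 - of_int r))"
| "basis_bracket (G r) (G s) = Poly_Mapping.single (L (r + s)) 2"

definition Ramond :: "ramond superalgebra" where
  "Ramond =
    \<lparr> smul = pm_scale,
      part = (\<lambda>i. {u. \<forall>b\<in>Poly_Mapping.keys u. basis_parity b = i}),
      bracket = (\<lambda>u v. linear_extension pm_scale
        (\<lambda>a. linear_extension pm_scale (basis_bracket a) v) u) \<rparr>"


section \<open>The modules \<open>\<Omega>\<^sub>R(\<lambda>, \<alpha>)\<close>\<close>

text \<open>
  The underlying space \<open>\<complex>[x\<^sup>2] \<oplus> x\<complex>[x\<^sup>2]\<close> is \<^typ>\<open>complex poly\<close>. A polynomial \<open>p\<close> in it is
  \<open>f(x\<^sup>2) + x g(x\<^sup>2)\<close> with \<open>f = even_coeffs p\<close> and \<open>g = odd_coeffs p\<close>, see \<open>even_odd_decomposition\<close>.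
  The polynomial \<open>x\<^sup>2 + c\<close> is \<open>[:c, 0, 1:]\<close> and \<open>f(x\<^sup>2 + c)\<close> is \<open>f \<circ>\<^sub>p [:c, 0, 1:]\<close>.
\<close>

definition even_coeffs :: "complex poly \<Rightarrow> complex poly" where
  "even_coeffs p = (\<Sum>n\<le>degree p. monom (coeff p (2 * n)) n)"

definition odd_coeffs :: "complex poly \<Rightarrow> complex poly" where
  "odd_coeffs p = (\<Sum>n\<le>degree p. monom (coeff p (2 * n + 1)) n)"

fun omega_basis_action ::
  "complex \<Rightarrow> complex \<Rightarrow> ramond_basis \<Rightarrow> complex poly \<Rightarrow> complex poly" where
  "omega_basis_action lam \<alpha> (L m) p =
     smult (lam powi m)
       ([:of_int m * \<alpha>, 0, 1:] * (even_coeffs p \<circ>\<^sub>p [:of_int m, 0, 1:])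
        + [:0, 1:] * [:of_int m * \<alpha> + of_int m / 2, 0, 1:] * (odd_coeffs p \<circ>\<^sub>p [:of_int m, 0, 1:]))"
| "omega_basis_action lam \<alpha> (G m) p =
     smult (lam powi m)
       ([:0, 1:] * (even_coeffs p \<circ>\<^sub>p [:of_int m, 0, 1:])
        + [:2 * of_int m * \<alpha>, 0, 1:] * (odd_coeffs p \<circ>\<^sub>p [:of_int m, 0, 1:]))"

definition Omega :: "complex \<Rightarrow> complex \<Rightarrow> (ramond, complex poly) supermodule" where
  "Omega lam \<alpha> =
    \<lparr> smul = smult,
      part = (\<lambda>i. if i = 0 then range (\<lambda>f. f \<circ>\<^sub>p [:0, 0, 1:])
                  else range (\<lambda>f. [:0, 1:] * (f \<circ>\<^sub>p [:0, 0, 1:]))),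
      action = (\<lambda>u p. linear_extension smult (\<lambda>b. omega_basis_action lam \<alpha> b p) u) \<rparr>"


section \<open>Well-definedness\<close>

subsection \<open>Linear extension\<close>

lemma lookup_pm_scale [simp]: "Poly_Mapping.lookup (pm_scale c u) b = c * Poly_Mapping.lookup u b"
  by (simp add: pm_scale_def Poly_Mapping.map.rep_eq when_def)

lemma pm_scale_single [simp]:
  "pm_scale c (Poly_Mapping.single b z) = Poly_Mapping.single b (c * z)"
  by (rule poly_mapping_eqI) (simp add: lookup_single when_def)

lemma vector_space_pm_scale: "vector_space pm_scale"
  by unfold_locales (auto intro!: poly_mapping_eqI simp: lookup_add algebra_simps)

lemma vector_space_smult: "vector_space (smult :: complex \<Rightarrow> _)"
  by unfold_locales (auto simp: smult_add_right smult_add_left)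

lemma linear_extension_superset:
  assumes "vector_space s" "finite K" "Poly_Mapping.keys u \<subseteq> K"
  shows "linear_extension s f u = (\<Sum>b\<in>K. s (Poly_Mapping.lookup u b) (f b))"
proof -
  interpret vector_space s by fact
  show ?thesis
    unfolding linear_extension_def using assms(2,3)
    by (intro sum.mono_neutral_left) (auto simp: in_keys_iff)
qed

lemma linear_linear_extension:
  assumes "vector_space s"
  shows "Vector_Spaces.linear pm_scale s (linear_extension s f)"
proof -
  interpret V: vector_space s by fact
  interpret P: vector_space pm_scale by (rule vector_space_pm_scale)
  have "linear_extension s f (u + v) = linear_extension s f u + linear_extension s f v" for u v
  proof -
    let ?K = "Poly_Mapping.keys u \<union> Poly_Mapping.keys v"
    have "Poly_Mapping.keys (u + v) \<subseteq> ?K" by (rule keys_add)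
    then show ?thesis
      by (simp add: linear_extension_superset[OF assms, of ?K] lookup_add V.scale_left_distrib
          sum.distrib)
  qed
  moreover have "linear_extension s f (pm_scale c u) = s c (linear_extension s f u)" for c u
  proof -
    have "Poly_Mapping.keys (pm_scale c u) \<subseteq> Poly_Mapping.keys u"
      by (auto simp: in_keys_iff)
    then show ?thesis
      by (simp add: linear_extension_superset[OF assms, of "Poly_Mapping.keys u"]
          V.scale_sum_right)
  qed
  ultimately show ?thesis
    by (simp add: Vector_Spaces.linear_iff P.vector_space_axioms V.vector_space_axioms)
qed

lemma linear_extension_single [simp]:
  assumes "vector_space s"
  shows "linear_extension s f (Poly_Mapping.single b z) = s z (f b)"
proof -
  interpret vector_space s by fact
  show ?thesis by (cases "z = 0") (auto simp: linear_extension_def)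
qed

lemma linear_extension_linear_arg:
  assumes "\<And>b. Vector_Spaces.linear s t (f b)"
  shows "Vector_Spaces.linear s t (\<lambda>v. linear_extension t (\<lambda>b. f b v) u)"
proof -
  have lin: "vector_space s" "vector_space t" "f b (v + w) = f b v + f b w"
    "f b (s c v) = t c (f b v)" for b v w c
    using assms by (auto simp: Vector_Spaces.linear_iff)
  interpret T: vector_space t by (rule lin)
  show ?thesis
    by (simp add: Vector_Spaces.linear_iff lin linear_extension_def T.scale_right_distrib
        sum.distrib T.scale_sum_right mult.commute)
qed

lemma pm_decomp: "u = (\<Sum>b\<in>Poly_Mapping.keys u. pm_scale (Poly_Mapping.lookup u b) (Poly_Mapping.single b 1))"
proof (rule poly_mapping_eqI)
  fix k
  show "Poly_Mapping.lookup u k = Poly_Mapping.lookup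
    (\<Sum>b\<in>Poly_Mapping.keys u. pm_scale (Poly_Mapping.lookup u b) (Poly_Mapping.single b 1)) k"
    by (simp add: lookup_sum lookup_single when_def in_keys_iff)
qed

lemma linear_eq_on_keys:
  assumes f: "Vector_Spaces.linear pm_scale s f" and g: "Vector_Spaces.linear pm_scale s g"
    and eq: "\<And>b. b \<in> Poly_Mapping.keys u \<Longrightarrow>
      f (Poly_Mapping.single b 1) = g (Poly_Mapping.single b 1)"
  shows "f u = g u"
proof -
  interpret f: Vector_Spaces.linear pm_scale s f by fact
  interpret g: Vector_Spaces.linear pm_scale s g by fact
  show ?thesis
    by (subst (1 2) pm_decomp) (simp add: f.sum g.sum f.scale g.scale eq del: pm_scale_single)
qed

lemma linear_comp:
  assumes "Vector_Spaces.linear s t f" "Vector_Spaces.linear t r g"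
  shows "Vector_Spaces.linear s r (\<lambda>v. g (f v))"
  using assms by (simp add: Vector_Spaces.linear_iff)

lemma linear_plus:
  assumes "Vector_Spaces.linear s t f" "Vector_Spaces.linear s t g"
  shows "Vector_Spaces.linear s t (\<lambda>v. f v + g v)"
  using assms by (auto simp: Vector_Spaces.linear_iff vector_space_def module_def algebra_simps)

lemma linear_smul:
  assumes "Vector_Spaces.linear s t f"
  shows "Vector_Spaces.linear s t (\<lambda>v. t c (f v))"
  using assms by (auto simp: Vector_Spaces.linear_iff vector_space_def mult.commute)

lemma linear_minus:
  assumes "Vector_Spaces.linear s t f" "Vector_Spaces.linear s t g"
  shows "Vector_Spaces.linear s t (\<lambda>v. f v - g v)"
proof -
  have "vector_space t" using assms by (simp add: Vector_Spaces.linear_iff)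
  then interpret vector_space t .
  show ?thesis using assms by (auto simp: Vector_Spaces.linear_iff scale_right_diff_distrib)
qed

subsection \<open>The Ramond algebra\<close>

lemma Ramond_simps [simp]:
  "smul Ramond = pm_scale"
  "u \<in> part Ramond i \<longleftrightarrow> (\<forall>b\<in>Poly_Mapping.keys u. basis_parity b = i)"
  by (simp_all add: Ramond_def)

lemma bracket_single [simp]:
  "bracket Ramond (Poly_Mapping.single a y) (Poly_Mapping.single b z) =
    pm_scale (y * z) (basis_bracket a b)"
proof -
  interpret vector_space pm_scale by (rule vector_space_pm_scale)
  show ?thesis by (simp add: Ramond_def vector_space_pm_scale)
qed

lemma bracket_lin_left: "Vector_Spaces.linear pm_scale pm_scale (\<lambda>a. bracket Ramond a b)"
  by (simp add: Ramond_def linear_linear_extension vector_space_pm_scale)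

lemma bracket_lin_right: "Vector_Spaces.linear pm_scale pm_scale (\<lambda>b. bracket Ramond a b)"
  by (simp add: Ramond_def linear_linear_extension linear_extension_linear_arg vector_space_pm_scale)

lemmas linear_intros =
  linear_comp[OF bracket_lin_left bracket_lin_left] linear_comp[OF bracket_lin_left bracket_lin_right]
  linear_comp[OF bracket_lin_right bracket_lin_left] linear_comp[OF bracket_lin_right bracket_lin_right]
  bracket_lin_left bracket_lin_right linear_plus linear_minus linear_smul

lemma bit_cases: "(i::bit) = 0 \<or> i = 1" by (cases i) auto

lemma basis_bracket_parity:
  "c \<in> Poly_Mapping.keys (basis_bracket a b) \<Longrightarrow> basis_parity c = basis_parity a + basis_parity b"
  by (cases a; cases b) (auto split: if_splits)

lemma super_vector_space_Ramond: "super_vector_space Ramond"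
proof -
  interpret vector_space pm_scale by (rule vector_space_pm_scale)
  show ?thesis
  proof (unfold_locales, goal_cases)
    case (5 i)
    have "Poly_Mapping.keys (pm_scale c u) \<subseteq> Poly_Mapping.keys u" for c and u :: ramond
      by (auto simp: in_keys_iff)
    then show ?case
      using keys_add by (fastforce simp: module.subspace_def[OF module_axioms])
  next
    case 6
    show ?case by (auto intro!: poly_mapping_eqI simp: in_keys_iff)
  next
    case (7 v)
    define w where "w i = (\<Sum>b\<in>{b\<in>Poly_Mapping.keys v. basis_parity b = i}.
       Poly_Mapping.single b (Poly_Mapping.lookup v b))" for i
    have lw: "Poly_Mapping.lookup (w i) k = (if basis_parity k = i then Poly_Mapping.lookup v k else 0)" for i k
      by (simp add: w_def lookup_sum lookup_single when_def in_keys_iff)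
    have "w i \<in> part Ramond i" for i by (auto simp: in_keys_iff lw split: if_splits)
    moreover have "v = w 0 + w 1"
      by (rule poly_mapping_eqI) (auto simp: lookup_add lw)
    ultimately show ?case by blast
  qed (simp_all add: scale_right_distrib scale_left_distrib)
qed

lemma lie_superalgebra_Ramond: "lie_superalgebra Ramond"
proof -
  interpret super_vector_space Ramond by (rule super_vector_space_Ramond)
  have V: "vector_space pm_scale" by (rule vector_space_pm_scale)
  show ?thesis
  proof (intro lie_superalgebra.intro lie_superalgebra_axioms.intro, goal_cases)
    case (4 a i b j)
    have sub: "subspace (part Ramond (i + j))" by (rule subspace_part)
    have s: "bracket Ramond a b = (\<Sum>x\<in>Poly_Mapping.keys a. pm_scale (Poly_Mapping.lookup a x)
       (\<Sum>y\<in>Poly_Mapping.keys b. pm_scale (Poly_Mapping.lookup b y) (basis_bracket x y)))"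
      by (simp add: Ramond_def linear_extension_def)
    have "basis_bracket x y \<in> part Ramond (i + j)"
      if "x \<in> Poly_Mapping.keys a" "y \<in> Poly_Mapping.keys b" for x y
      using 4 that basis_bracket_parity by fastforce
    then show ?case unfolding s
      by (intro subspace_sum[OF sub] subspace_scale[OF sub, unfolded Ramond_simps(1)]) blast+
  next
    case (5 a i b j)
    show ?case unfolding Ramond_simps
    proof (rule linear_eq_on_keys[where f = "\<lambda>a. bracket Ramond a b" and s = pm_scale])
      fix x assume x: "x \<in> Poly_Mapping.keys a"
      show "bracket Ramond (Poly_Mapping.single x 1) b =
        pm_scale (- parity_sign i j) (bracket Ramond b (Poly_Mapping.single x 1))"
      proof (rule linear_eq_on_keys[where u = b and s = pm_scale])
        fix y assume y: "y \<in> Poly_Mapping.keys b"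
        have "basis_parity x = i" "basis_parity y = j" using 5 x y by auto
        then show "bracket Ramond (Poly_Mapping.single x 1) (Poly_Mapping.single y 1) =
          pm_scale (- parity_sign i j) (bracket Ramond (Poly_Mapping.single y 1) (Poly_Mapping.single x 1))"
          by (cases x; cases y) (auto simp: parity_sign_def add.commute)
      qed (intro linear_intros)+
    qed (intro linear_intros)+
  next
    case (6 a i b j c k)
    define h :: "int \<Rightarrow> complex" where "h m = of_int m / 2" for m
    have h: "of_int m = 2 * h m" for m by (simp add: h_def)
    have h_add: "h (m + n) = h m + h n" for m n by (simp add: h_def add_divide_distrib)
    show ?case unfolding Ramond_simps
    proof (rule linear_eq_on_keys[where u = a and s = pm_scale])
      fix x assume x: "x \<in> Poly_Mapping.keys a"
      let ?x = "Poly_Mapping.single x 1"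
      show "bracket Ramond ?x (bracket Ramond b c) = bracket Ramond (bracket Ramond ?x b) c +
        pm_scale (parity_sign i j) (bracket Ramond b (bracket Ramond ?x c))"
      proof (rule linear_eq_on_keys[where u = b and s = pm_scale])
        fix y assume y: "y \<in> Poly_Mapping.keys b"
        let ?y = "Poly_Mapping.single y 1"
        show "bracket Ramond ?x (bracket Ramond ?y c) = bracket Ramond (bracket Ramond ?x ?y) c +
          pm_scale (parity_sign i j) (bracket Ramond ?y (bracket Ramond ?x c))"
        proof (rule linear_eq_on_keys[where u = c and s = pm_scale])
          fix z assume z: "z \<in> Poly_Mapping.keys c"
          let ?z = "Poly_Mapping.single z 1"
          have "basis_parity x = i" "basis_parity y = j" "basis_parity z = k" using 6 x y z by auto
          then show "bracket Ramond ?x (bracket Ramond ?y ?z) = bracket Ramond (bracket Ramond ?x ?y) ?z +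
            pm_scale (parity_sign i j) (bracket Ramond ?y (bracket Ramond ?x ?z))"
            apply (cases x; cases y; cases z;
                simp add: parity_sign_def h h_add add_divide_distrib diff_divide_distrib algebra_simps
                  flip: single_add single_uminus single_diff)
            done
        qed (intro linear_intros)+
      qed (intro linear_intros)+
    qed (intro linear_intros)+
  qed (simp_all add: bracket_lin_left bracket_lin_right super_vector_space_axioms)
qed


subsection \<open>The modules \<open>\<Omega>\<^sub>R(\<lambda>, \<alpha>)\<close>\<close>

lemma coeff_even_coeffs [simp]: "coeff (even_coeffs p) n = coeff p (2 * n)"
  by (auto simp: even_coeffs_def coeff_sum coeff_eq_0)

lemma coeff_odd_coeffs [simp]: "coeff (odd_coeffs p) n = coeff p (Suc (2 * n))"
  by (auto simp: odd_coeffs_def coeff_sum coeff_eq_0)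

lemma coeff_pcompose_square:
  fixes f :: "complex poly"
  shows "coeff (f \<circ>\<^sub>p [:0, 0, 1:]) n = (if even n then coeff f (n div 2) else 0)"
proof (induction f arbitrary: n)
  case (pCons a f)
  show ?case
  proof (cases n)
    case (Suc k)
    then show ?thesis
      by (cases k) (auto simp: pcompose_pCons pCons.IH)
  qed (simp add: pcompose_pCons)
qed simp

lemma even_odd_decomposition:
  "p = even_coeffs p \<circ>\<^sub>p [:0, 0, 1:] + [:0, 1:] * (odd_coeffs p \<circ>\<^sub>p [:0, 0, 1:])"
proof (rule poly_eqI)
  fix n
  show "coeff p n =
    coeff (even_coeffs p \<circ>\<^sub>p [:0, 0, 1:] + [:0, 1:] * (odd_coeffs p \<circ>\<^sub>p [:0, 0, 1:])) n"
    by (cases n) (auto simp: coeff_pcompose_square poly_0_coeff_0 elim!: oddE evenE)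
qed

lemma even_coeffs_simps [simp]:
  "even_coeffs (f \<circ>\<^sub>p [:0, 0, 1:]) = f" "even_coeffs ([:0, 1:] * (f \<circ>\<^sub>p [:0, 0, 1:])) = 0"
  "even_coeffs (p + q) = even_coeffs p + even_coeffs q"
  "even_coeffs (smult c p) = smult c (even_coeffs p)"
proof -
  show "even_coeffs ([:0, 1:] * (f \<circ>\<^sub>p [:0, 0, 1:])) = 0"
    by (rule poly_eqI) (auto simp: coeff_pCons coeff_pcompose_square split: nat.split, presburger)
qed (rule poly_eqI; simp add: coeff_pcompose_square)+

lemma odd_coeffs_simps [simp]:
  "odd_coeffs (f \<circ>\<^sub>p [:0, 0, 1:]) = 0" "odd_coeffs ([:0, 1:] * (f \<circ>\<^sub>p [:0, 0, 1:])) = f"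
  "odd_coeffs (p + q) = odd_coeffs p + odd_coeffs q"
  "odd_coeffs (smult c p) = smult c (odd_coeffs p)"
  by (rule poly_eqI; simp add: coeff_pcompose_square)+

lemma Omega_simps [simp]:
  "smul (Omega lam \<alpha>) = smult"
  "part (Omega lam \<alpha>) 0 = range (\<lambda>f. f \<circ>\<^sub>p [:0, 0, 1:])"
  "part (Omega lam \<alpha>) 1 = range (\<lambda>f. [:0, 1:] * (f \<circ>\<^sub>p [:0, 0, 1:]))"
  by (simp_all add: Omega_def)

lemma action_single [simp]:
  "action (Omega lam \<alpha>) (Poly_Mapping.single b z) p = smult z (omega_basis_action lam \<alpha> b p)"
  by (simp add: Omega_def vector_space_smult)

lemma Omega_action_formulas:
  fixes f :: "complex poly" and m :: int
  shows "action (Omega lam \<alpha>) (Poly_Mapping.single (L m) 1) (f \<circ>\<^sub>p [:0, 0, 1:]) =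
      smult (lam powi m) ([:of_int m * \<alpha>, 0, 1:] * (f \<circ>\<^sub>p [:of_int m, 0, 1:]))"
    and "action (Omega lam \<alpha>) (Poly_Mapping.single (L m) 1) ([:0, 1:] * (f \<circ>\<^sub>p [:0, 0, 1:])) =
      smult (lam powi m)
        ([:0, 1:] * [:of_int m * \<alpha> + of_int m / 2, 0, 1:] * (f \<circ>\<^sub>p [:of_int m, 0, 1:]))"
    and "action (Omega lam \<alpha>) (Poly_Mapping.single (G m) 1) (f \<circ>\<^sub>p [:0, 0, 1:]) =
      smult (lam powi m) ([:0, 1:] * (f \<circ>\<^sub>p [:of_int m, 0, 1:]))"
    and "action (Omega lam \<alpha>) (Poly_Mapping.single (G m) 1) ([:0, 1:] * (f \<circ>\<^sub>p [:0, 0, 1:])) =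
      smult (lam powi m) ([:2 * of_int m * \<alpha>, 0, 1:] * (f \<circ>\<^sub>p [:of_int m, 0, 1:]))"
  by (simp_all del: mult_pCons_left)

definition ev :: "complex poly \<Rightarrow> complex poly" where "ev f = f \<circ>\<^sub>p [:0, 0, 1:]"
definition od :: "complex poly \<Rightarrow> complex poly" where "od f = [:0, 1:] * (f \<circ>\<^sub>p [:0, 0, 1:])"

lemma ev_od_coeffs [simp]:
  "even_coeffs (ev f) = f" "even_coeffs (od f) = 0" "odd_coeffs (ev f) = 0" "odd_coeffs (od f) = f"
  by (simp_all add: ev_def od_def del: mult_pCons_left)

lemma ev_od_linear:
  "ev (f + g) = ev f + ev g" "od (f + g) = od f + od g"
  "ev (f - g) = ev f - ev g" "od (f - g) = od f - od g"
  "ev (smult c f) = smult c (ev f)" "od (smult c f) = smult c (od f)"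
  by (simp_all add: ev_def od_def pcompose_add pcompose_diff pcompose_smult algebra_simps
      smult_add_right smult_diff_right del: mult_pCons_left)

lemma basis_action_ev_od:
  "omega_basis_action lam \<alpha> (L m) (ev f) =
     ev (smult (lam powi m) ([:of_int m * \<alpha>, 1:] * (f \<circ>\<^sub>p [:of_int m, 1:])))"
  "omega_basis_action lam \<alpha> (L m) (od f) =
     od (smult (lam powi m) ([:of_int m * \<alpha> + of_int m / 2, 1:] * (f \<circ>\<^sub>p [:of_int m, 1:])))"
  "omega_basis_action lam \<alpha> (G m) (ev f) = od (smult (lam powi m) (f \<circ>\<^sub>p [:of_int m, 1:]))"
  "omega_basis_action lam \<alpha> (G m) (od f) =
     ev (smult (lam powi m) ([:2 * of_int m * \<alpha>, 1:] * (f \<circ>\<^sub>p [:of_int m, 1:])))"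
  by (rule poly_eq_poly_eq_iff[THEN iffD1], rule ext,
      simp del: mult_pCons_left, simp add: ev_def od_def poly_pcompose algebra_simps)+

lemma basis_action_linear: "Vector_Spaces.linear smult smult (omega_basis_action lam \<alpha> b)"
proof (cases b)
  case (L m)
  show ?thesis unfolding L
    by (simp add: Vector_Spaces.linear_iff vector_space_smult pcompose_add pcompose_smult
        algebra_simps smult_add_right del: mult_pCons_left)
next
  case (G m)
  show ?thesis unfolding G
    by (simp add: Vector_Spaces.linear_iff vector_space_smult pcompose_add pcompose_smult
        algebra_simps smult_add_right del: mult_pCons_left)
qed

lemma action_lin_left: "Vector_Spaces.linear pm_scale smult (\<lambda>a. action (Omega lam \<alpha>) a v)"
  by (simp add: Omega_def linear_linear_extension vector_space_smult)

lemma action_lin_right: "Vector_Spaces.linear smult smult (\<lambda>v. action (Omega lam \<alpha>) a v)"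
  by (simp add: Omega_def linear_extension_linear_arg basis_action_linear)

lemmas action_linear_intros =
  linear_comp[OF action_lin_left action_lin_right]
  linear_comp[OF bracket_lin_left action_lin_left]
  linear_comp[OF bracket_lin_right action_lin_left]
  action_lin_left action_lin_right linear_minus linear_smul

lemma super_vector_space_Omega: "super_vector_space (Omega lam \<alpha>)"
proof -
  interpret vector_space "smult :: complex \<Rightarrow> _" by (rule vector_space_smult)
  show ?thesis
  proof (unfold_locales, goal_cases)
    case (5 i)
    have "subspace (range ev)" "subspace (range od)"
      unfolding subspace_def
      by (auto simp flip: ev_od_linear) (metis ev_def od_def mult_zero_right pcompose_0 rangeI)+
    then show ?case using bit_cases[of i] by (auto simp: ev_def[abs_def] od_def[abs_def])
  next
    case 6
    have "ev f = 0" if "ev f = od g" for f g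
    proof -
      have "f = even_coeffs (od g)" using that by (metis ev_od_coeffs(1))
      then show ?thesis by (simp add: ev_def)
    qed
    moreover have "0 \<in> range ev" "0 \<in> range od"
      by (rule range_eqI[of _ _ 0]; simp add: ev_def od_def)+
    ultimately have "range ev \<inter> range od = {0}"
      unfolding set_eq_iff by (blast)
    then show ?case by (simp add: ev_def[abs_def] od_def[abs_def])
  next
    case (7 v)
    show ?case
      using even_odd_decomposition[of v] by (fastforce simp del: mult_pCons_left)
  qed (simp_all add: smult_add_right smult_add_left)
qed

lemma basis_action_bracket:
  assumes "lam \<noteq> 0"
  shows "action (Omega lam \<alpha>) (basis_bracket x y) p =
    omega_basis_action lam \<alpha> x (omega_basis_action lam \<alpha> y p) -
    smult (parity_sign (basis_parity x) (basis_parity y))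
      (omega_basis_action lam \<alpha> y (omega_basis_action lam \<alpha> x p))" (is "?l p = ?r p")
proof -
  have lin: "Vector_Spaces.linear smult smult ?l" "Vector_Spaces.linear smult smult ?r"
    by (intro action_lin_right linear_minus linear_smul
        linear_comp[OF basis_action_linear basis_action_linear])+
  define h :: "int \<Rightarrow> complex" where "h m = of_int m / 2" for m
  have h: "of_int m = 2 * h m" for m by (simp add: h_def)
    have h_add: "h (m + n) = h m + h n" for m n by (simp add: h_def add_divide_distrib)
  have ev: "?l (ev f) = ?r (ev f)" for f
    using assms
    apply (cases x; cases y; simp del: omega_basis_action.simps mult_pCons_left smult_pCons add: basis_action_ev_od 
        parity_sign_def flip: ev_od_linear)
       apply (rule arg_cong[of _ _ ev] arg_cong[of _ _ od],
        rule poly_eq_poly_eq_iff[THEN iffD1], rule ext,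
        simp add: poly_pcompose power_int_add h h_add add_divide_distrib algebra_simps)+
    done
  have od: "?l (od f) = ?r (od f)" for f
    using assms
    apply (cases x; cases y; simp del: omega_basis_action.simps mult_pCons_left smult_pCons add: basis_action_ev_od 
        parity_sign_def flip: ev_od_linear)
       apply (rule arg_cong[of _ _ ev] arg_cong[of _ _ od],
        rule poly_eq_poly_eq_iff[THEN iffD1], rule ext,
        simp add: poly_pcompose power_int_add h h_add add_divide_distrib algebra_simps)+
    done
  have p: "p = ev (even_coeffs p) + od (odd_coeffs p)"
    using even_odd_decomposition[of p] by (simp add: ev_def od_def)
  have "?l p = ?l (ev (even_coeffs p)) + ?l (od (odd_coeffs p))"
    using lin(1) p by (metis Vector_Spaces.linear_iff)
  also have "\<dots> = ?r (ev (even_coeffs p)) + ?r (od (odd_coeffs p))"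
    by (simp only: ev od)
  also have "\<dots> = ?r p"
    using lin(2) p by (metis (no_types, lifting) Vector_Spaces.linear_iff)
  finally show ?thesis .
qed

lemma basis_action_part:
  assumes "v \<in> part (Omega lam \<alpha>) j"
  shows "omega_basis_action lam \<alpha> b v \<in> part (Omega lam \<alpha>) (basis_parity b + j)"
proof -
  have parts: "part (Omega lam \<alpha>) 0 = range ev" "part (Omega lam \<alpha>) 1 = range od"
    by (simp_all add: ev_def[abs_def] od_def[abs_def])
  show ?thesis
    using assms bit_cases[of j]
    by (cases b) (auto simp: parts basis_action_ev_od simp del: Omega_simps omega_basis_action.simps)
qed

theorem lie_supermodule_Omega:
  assumes "lam \<noteq> 0"
  shows "lie_supermodule Ramond (Omega lam \<alpha>)"
proof -
  interpret R: lie_superalgebra Ramond by (rule lie_superalgebra_Ramond)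
  interpret M: super_vector_space "Omega lam \<alpha>" by (rule super_vector_space_Omega)
  show ?thesis
  proof (intro lie_supermodule.intro lie_supermodule_axioms.intro, goal_cases)
    case (5 a i v j)
    have s: "action (Omega lam \<alpha>) a v = (\<Sum>b\<in>Poly_Mapping.keys a.
        smul (Omega lam \<alpha>) (Poly_Mapping.lookup a b) (omega_basis_action lam \<alpha> b v))"
      by (simp add: Omega_def linear_extension_def)
    have "omega_basis_action lam \<alpha> b v \<in> part (Omega lam \<alpha>) (i + j)"
      if "b \<in> Poly_Mapping.keys a" for b
      using basis_action_part[OF 5(2), of b] 5(1) that by simp
    then show ?case unfolding s
      by (intro M.subspace_sum[OF M.subspace_part] M.subspace_scale[OF M.subspace_part])
  next
    case (6 a i b j v)
    show ?case unfolding Omega_simps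
    proof (rule linear_eq_on_keys[where u = a and s = smult])
      fix x assume x: "x \<in> Poly_Mapping.keys a"
      let ?x = "Poly_Mapping.single x 1"
      show "action (Omega lam \<alpha>) (bracket Ramond ?x b) v =
        action (Omega lam \<alpha>) ?x (action (Omega lam \<alpha>) b v) -
        smult (parity_sign i j) (action (Omega lam \<alpha>) b (action (Omega lam \<alpha>) ?x v))"
      proof (rule linear_eq_on_keys[where u = b and s = smult])
        fix y assume y: "y \<in> Poly_Mapping.keys b"
        let ?y = "Poly_Mapping.single y 1"
        have "basis_parity x = i" "basis_parity y = j" using 6 x y by auto
        moreover have "pm_scale 1 u = u" for u :: ramond by (rule poly_mapping_eqI) simp
        ultimately show "action (Omega lam \<alpha>) (bracket Ramond ?x ?y) v =
          action (Omega lam \<alpha>) ?x (action (Omega lam \<alpha>) ?y v) -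
          smult (parity_sign i j) (action (Omega lam \<alpha>) ?y (action (Omega lam \<alpha>) ?x v))"
          using basis_action_bracket[OF assms, of \<alpha> x y v] by simp
      qed (intro action_linear_intros)+
    qed (intro action_linear_intros)+
  qed (simp_all add: action_lin_left action_lin_right R.lie_superalgebra_axioms M.super_vector_space_axioms)
qed

end

theory Submission
  imports Defs
begin

text \<open>
  An isomorphism \<open>\<phi>\<close> sends the even vector 1 to some nonzero \<open>g(x\<^sup>2)\<close>. Since \<open>L\<^sub>0\<close> is multiplication by
  \<open>x\<^sup>2\<close> and \<open>G\<^sub>0\<close> maps 1 to \<open>x\<close>, this gives \<open>\<phi>(x\<^sup>2) = x\<^sup>2 g(x\<^sup>2)\<close> and \<open>\<phi>(x) = x g(x\<^sup>2)\<close>.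
  Compatibility with \<open>G\<^sub>1\<close> on 1 reads \<open>\<lambda> g(t) = \<mu> g(t + 1)\<close>, so \<open>\<lambda> = \<mu>\<close> by comparing leading
  coefficients. Compatibility with \<open>L\<^sub>1\<close> on 1 reads \<open>\<lambda> (t + \<alpha>) g(t) = \<mu> (t + \<beta>) g(t + 1)\<close>, and
  cancelling the first relation leaves \<open>t + \<alpha> = t + \<beta>\<close>.
\<close>

text \<open>In the variable t = x^2 hidden by \<open>ev\<close> and \<open>od\<close>, the operators
  act through the translation t -> t + m.\<close>

lemma ramond_action_on_even:
  "action (Omega lam \<alpha>) (Poly_Mapping.single (L m) 1) (ev f) =
     ev (smult (lam powi m) ([:of_int m * \<alpha>, 1:] * (f \<circ>\<^sub>p [:of_int m, 1:])))"
  "action (Omega lam \<alpha>) (Poly_Mapping.single (G m) 1) (ev f) =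
     od (smult (lam powi m) (f \<circ>\<^sub>p [:of_int m, 1:]))"
  by (simp_all only: action_single basis_action_ev_od smult_1_left)

lemma ev_inject: "ev f = ev g \<Longrightarrow> f = g"
  by (metis ev_od_coeffs(1))

lemma od_inject: "od f = od g \<Longrightarrow> f = g"
  by (metis ev_od_coeffs(4))

lemma isomorphic_supermodules_refl:
  assumes "lie_supermodule A M"
  shows "isomorphic_supermodules A M M"
proof -
  interpret lie_supermodule A M by fact
  have "supermodule_isomorphism A M M id"
    by unfold_locales simp_all
  then show ?thesis
    by (auto simp: isomorphic_supermodules_def)
qed

text \<open>Composition with the monic linear \<open>[:c, 1:]\<close> preserves leading
  coefficients.\<close>

lemma smult_shift_eq_imp:
  fixes g :: "complex poly"
  assumes "g \<noteq> 0" and "smult a g = smult b (g \<circ>\<^sub>p [:c, 1:])"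
  shows "a = b"
proof -
  have "lead_coeff (g \<circ>\<^sub>p [:c, 1:]) = lead_coeff g"
    by (subst lead_coeff_comp) simp_all
  then have "a * lead_coeff g = b * lead_coeff g"
    using arg_cong[OF assms(2), of lead_coeff] by (simp only: lead_coeff_smult)
  with \<open>g \<noteq> 0\<close> show ?thesis by simp
qed

lemma Omega_isomorphism_parameters:
  assumes "lam \<noteq> 0" and "supermodule_isomorphism Ramond (Omega lam \<alpha>) (Omega \<mu> \<beta>) \<phi>"
  shows "lam = \<mu> \<and> \<alpha> = \<beta>"
proof -
  interpret supermodule_isomorphism Ramond "Omega lam \<alpha>" "Omega \<mu> \<beta>" \<phi> by fact
  have add: "\<phi> (p + q) = \<phi> p + \<phi> q" and scale: "\<phi> (smult c p) = smult c (\<phi> p)" for p q c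
    using iso_linear by (simp_all add: Vector_Spaces.linear_iff)
  have "ev 1 \<in> part (Omega lam \<alpha>) 0"
    by (simp add: ev_def)
  from iso_part[OF this] obtain g where g: "\<phi> (ev 1) = ev g"
    by (auto simp: ev_def)
  have "g \<noteq> 0"
  proof
    assume "g = 0"
    then have "\<phi> (ev 1) = \<phi> 0"
      using g scale[of 0 0] by (simp add: ev_def)
    then have "ev 1 = 0"
      using iso_bij by (simp add: bij_def inj_eq)
    then show False by (simp add: ev_def pcompose_1)
  qed
  have x2: "\<phi> (ev [:0, 1:]) = ev ([:0, 1:] * g)"
    using iso_action[of "Poly_Mapping.single (L 0) 1" "ev 1"]
    by (simp add: ramond_action_on_even g del: action_single mult_pCons_left)
  have x: "\<phi> (od 1) = od g"
    using iso_action[of "Poly_Mapping.single (G 0) 1" "ev 1"]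
    by (simp only: ramond_action_on_even g pcompose_1 pcompose_idR of_int_0
        power_int_0_right smult_1_left)
  have G1: "smult lam g = smult \<mu> (g \<circ>\<^sub>p [:1, 1:])"
    by (rule od_inject, insert iso_action[of "Poly_Mapping.single (G 1) 1" "ev 1"])
      (simp only: ramond_action_on_even g x ev_od_linear scale pcompose_1 of_int_1
        power_int_1_right)
  \<comment> \<open>Up to the factor \<open>lam\<close>, this argument is \<open>L 1\<close> applied
    to 1.\<close>
  have x2_plus: "\<phi> (ev [:\<alpha>, 1:]) = ev ([:\<alpha>, 1:] * g)"
  proof -
    have "[:\<alpha>, 1:] = smult \<alpha> 1 + [:0, 1:]" by simp
    then have "\<phi> (ev [:\<alpha>, 1:]) = ev (smult \<alpha> g + [:0, 1:] * g)"
      by (simp only: ev_od_linear add scale g x2)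
    then show ?thesis by simp
  qed
  have "smult lam ([:\<alpha>, 1:] * g) = smult \<mu> ([:\<beta>, 1:] * (g \<circ>\<^sub>p [:1, 1:]))"
    by (rule ev_inject, insert iso_action[of "Poly_Mapping.single (L 1) 1" "ev 1"])
      (simp only: ramond_action_on_even g x2_plus ev_od_linear scale pcompose_1 of_int_1 mult_1_left
        mult_1_right power_int_1_right)
  \<comment> \<open>\<open>G1\<close> removes the translation and trades \<mu> for
    \<open>lam\<close>, leaving a common factor \<open>g\<close>.\<close>
  also have "\<dots> = smult lam ([:\<beta>, 1:] * g)"
    by (simp only: mult_smult_right [symmetric] G1)
  finally have "[:\<alpha>, 1:] * g = [:\<beta>, 1:] * g"
    using \<open>lam \<noteq> 0\<close> by (metis smult_smult left_inverse smult_1_left)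
  then have "[:\<alpha>, 1:] = [:\<beta>, 1:]"
    using \<open>g \<noteq> 0\<close> by (simp only: mult_cancel_right) auto
  with smult_shift_eq_imp[OF \<open>g \<noteq> 0\<close> G1] show ?thesis by simp
qed

theorem theorem2p7:
  fixes lam \<mu> \<alpha> \<beta> :: complex
  assumes "lam \<noteq> 0" and "\<mu> \<noteq> 0"
  shows "isomorphic_supermodules Ramond (Omega lam \<alpha>) (Omega \<mu> \<beta>) \<longleftrightarrow> lam = \<mu> \<and> \<alpha> = \<beta>"
proof
  assume "isomorphic_supermodules Ramond (Omega lam \<alpha>) (Omega \<mu> \<beta>)"
  then show "lam = \<mu> \<and> \<alpha> = \<beta>"
    using Omega_isomorphism_parameters[OF assms(1)] by (auto simp: isomorphic_supermodules_def)
next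
  assume "lam = \<mu> \<and> \<alpha> = \<beta>"
  then show "isomorphic_supermodules Ramond (Omega lam \<alpha>) (Omega \<mu> \<beta>)"
    \<comment> \<open>Isomorphism includes the supermodule axioms, so the identity qualifies only
      once these hold for \<open>Omega\<close>.\<close>
    using isomorphic_supermodules_refl[OF lie_supermodule_Omega] assms by simp
qed

end
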